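(* Let $k\ge 0$, let $X$ be a set with $k+1$ elements, and let $\mathcal L(X)=\bigcup_{i=0}^{k}\mathcal I(\mathcal B_k)_{[s_i,t_i]}$. Then $$|\mathcal L(X)|=\sum_{i=1}^{k+1}\binom{k+1}{i}(-1)^{i+1}\,3^{\Phi(k,i-1)},\qquad\text{where } \Phi(k,l)=3^{k}\left(\tfrac23\right)^{l}.$$
   Context: For a Boolean algebra $B$ (complement $\overline{b}$), the interval algebra is $\mathcal I(B)=\{[a,b]: a\le b \text{ in } B\}$ ordered by inclusion ($[c,d]\le[a,b]$ iff $a\le c$ and $d\le b$), with $\mathbf 1=[0,1]$, $[a,b]\vee[c,d]=[a\wedge c,b\vee d]$, and, for $[c,d]\le[a,b]$, $\Delta([a,b],[c,d])=[a\vee(b\wedge\overline d),\,b\wedge(a\vee\overline c)]$. For $\mathcal L=\mathcal I(B)$ and $\mathbf a\in\mathcal L$, the localization is $\mathcal L_{\mathbf a}=\{\Delta(\mathbf y,\mathbf x): \mathbf a\le \mathbf x\le \mathbf y\}$. For $k\ge 0$, $\mathcal B_k$ is the Boolean algebra generated by $s_0,\dots,s_k,t_0,\dots,t_k$ subject to the relations (i.e. the corresponding quotient of the free Boolean algebra on these $2k+2$ generators): $s_0=0$; $s_i\le t_i$ for $0\le i\le k$; $t_0\le\bigvee_{j=1}^{i}s_j\vee t_{i+1}$ for $0\le i<k$; $t_0\le\bigvee_{j=1}^{k}s_j$. Empty joins are $0$. *)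

theory Defs
  imports Complex_Main "HOL-Algebra.Congruence"
begin

section \<open>Boolean algebras with explicit carrier\<close>

text \<open>
  The algebras considered below vary with a natural number, so they cannot be types of
  class \<open>boolean_algebra\<close>; they are records with a carrier set.
\<close>

record 'a ba = "'a partial_object" +
  ba_meet :: "'a \<Rightarrow> 'a \<Rightarrow> 'a"
  ba_join :: "'a \<Rightarrow> 'a \<Rightarrow> 'a"
  ba_neg :: "'a \<Rightarrow> 'a"
  ba_bot :: "'a"
  ba_top :: "'a"

locale bool_alg =
  fixes B :: "('a, 'm) ba_scheme"
  assumes meet_closed: "x \<in> carrier B \<Longrightarrow> y \<in> carrier B \<Longrightarrow> ba_meet B x y \<in> carrier B"
    and join_closed: "x \<in> carrier B \<Longrightarrow> y \<in> carrier B \<Longrightarrow> ba_join B x y \<in> carrier B"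
    and neg_closed: "x \<in> carrier B \<Longrightarrow> ba_neg B x \<in> carrier B"
    and bot_closed: "ba_bot B \<in> carrier B"
    and top_closed: "ba_top B \<in> carrier B"
    and meet_assoc: "x \<in> carrier B \<Longrightarrow> y \<in> carrier B \<Longrightarrow> z \<in> carrier B \<Longrightarrow>
          ba_meet B (ba_meet B x y) z = ba_meet B x (ba_meet B y z)"
    and join_assoc: "x \<in> carrier B \<Longrightarrow> y \<in> carrier B \<Longrightarrow> z \<in> carrier B \<Longrightarrow>
          ba_join B (ba_join B x y) z = ba_join B x (ba_join B y z)"
    and meet_comm: "x \<in> carrier B \<Longrightarrow> y \<in> carrier B \<Longrightarrow> ba_meet B x y = ba_meet B y x"
    and join_comm: "x \<in> carrier B \<Longrightarrow> y \<in> carrier B \<Longrightarrow> ba_join B x y = ba_join B y x"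
    and meet_join_distrib: "x \<in> carrier B \<Longrightarrow> y \<in> carrier B \<Longrightarrow> z \<in> carrier B \<Longrightarrow>
          ba_meet B x (ba_join B y z) = ba_join B (ba_meet B x y) (ba_meet B x z)"
    and join_meet_distrib: "x \<in> carrier B \<Longrightarrow> y \<in> carrier B \<Longrightarrow> z \<in> carrier B \<Longrightarrow>
          ba_join B x (ba_meet B y z) = ba_meet B (ba_join B x y) (ba_join B x z)"
    and meet_top: "x \<in> carrier B \<Longrightarrow> ba_meet B x (ba_top B) = x"
    and join_bot: "x \<in> carrier B \<Longrightarrow> ba_join B x (ba_bot B) = x"
    and meet_neg: "x \<in> carrier B \<Longrightarrow> ba_meet B x (ba_neg B x) = ba_bot B"
    and join_neg: "x \<in> carrier B \<Longrightarrow> ba_join B x (ba_neg B x) = ba_top B"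

definition ba_le :: "('a, 'm) ba_scheme \<Rightarrow> 'a \<Rightarrow> 'a \<Rightarrow> bool" where
  "ba_le B x y \<longleftrightarrow> ba_meet B x y = x"


section \<open>The interval algebra and its localizations\<close>

text \<open>The interval \<open>[a,b]\<close> with \<open>a \<le> b\<close> is represented by its pair of endpoints.\<close>

definition interval_algebra :: "('a, 'm) ba_scheme \<Rightarrow> ('a \<times> 'a) set" where
  "interval_algebra B = {(a, b). a \<in> carrier B \<and> b \<in> carrier B \<and> ba_le B a b}"

definition interval_le :: "('a, 'm) ba_scheme \<Rightarrow> 'a \<times> 'a \<Rightarrow> 'a \<times> 'a \<Rightarrow> bool" where
  "interval_le B x y \<longleftrightarrow> ba_le B (fst y) (fst x) \<and> ba_le B (snd x) (snd y)"

fun interval_Delta :: "('a, 'm) ba_scheme \<Rightarrow> 'a \<times> 'a \<Rightarrow> 'a \<times> 'a \<Rightarrow> 'a \<times> 'a" where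
  "interval_Delta B (a, b) (c, d) =
     (ba_join B a (ba_meet B b (ba_neg B d)), ba_meet B b (ba_join B a (ba_neg B c)))"

definition localization :: "('a, 'm) ba_scheme \<Rightarrow> 'a \<times> 'a \<Rightarrow> ('a \<times> 'a) set" where
  "localization B u =
     {interval_Delta B y x | x y. x \<in> interval_algebra B \<and> y \<in> interval_algebra B \<and>
        interval_le B u x \<and> interval_le B x y}"


section \<open>Boolean algebras given by generators and relations\<close>

datatype (gens: 'g) bterm =
    Gen 'g | Bot | Top | Neg "'g bterm" | Meet "'g bterm" "'g bterm" | Join "'g bterm" "'g bterm"

definition bterms :: "'g set \<Rightarrow> 'g bterm set" where
  "bterms G = {p. gens p \<subseteq> G}"

text \<open>
  The least congruence on the terms over \<open>G\<close> that contains the axioms of Boolean algebras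
  and the pairs in \<open>R\<close>. For \<open>R = {}\<close> the quotient is the free Boolean algebra on \<open>G\<close>.
\<close>

inductive_set ba_cong :: "'g set \<Rightarrow> ('g bterm \<times> 'g bterm) set \<Rightarrow> ('g bterm \<times> 'g bterm) set"
  for G :: "'g set" and R :: "('g bterm \<times> 'g bterm) set" where
  rel: "(p, q) \<in> R \<Longrightarrow> p \<in> bterms G \<Longrightarrow> q \<in> bterms G \<Longrightarrow> (p, q) \<in> ba_cong G R"
| refl: "p \<in> bterms G \<Longrightarrow> (p, p) \<in> ba_cong G R"
| sym: "(p, q) \<in> ba_cong G R \<Longrightarrow> (q, p) \<in> ba_cong G R"
| trans: "(p, q) \<in> ba_cong G R \<Longrightarrow> (q, r) \<in> ba_cong G R \<Longrightarrow> (p, r) \<in> ba_cong G R"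
| neg: "(p, q) \<in> ba_cong G R \<Longrightarrow> (Neg p, Neg q) \<in> ba_cong G R"
| meet: "(p, p') \<in> ba_cong G R \<Longrightarrow> (q, q') \<in> ba_cong G R \<Longrightarrow> (Meet p q, Meet p' q') \<in> ba_cong G R"
| join: "(p, p') \<in> ba_cong G R \<Longrightarrow> (q, q') \<in> ba_cong G R \<Longrightarrow> (Join p q, Join p' q') \<in> ba_cong G R"
| meet_assoc: "p \<in> bterms G \<Longrightarrow> q \<in> bterms G \<Longrightarrow> r \<in> bterms G \<Longrightarrow>
    (Meet (Meet p q) r, Meet p (Meet q r)) \<in> ba_cong G R"
| join_assoc: "p \<in> bterms G \<Longrightarrow> q \<in> bterms G \<Longrightarrow> r \<in> bterms G \<Longrightarrow>
    (Join (Join p q) r, Join p (Join q r)) \<in> ba_cong G R"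
| meet_comm: "p \<in> bterms G \<Longrightarrow> q \<in> bterms G \<Longrightarrow> (Meet p q, Meet q p) \<in> ba_cong G R"
| join_comm: "p \<in> bterms G \<Longrightarrow> q \<in> bterms G \<Longrightarrow> (Join p q, Join q p) \<in> ba_cong G R"
| meet_join: "p \<in> bterms G \<Longrightarrow> q \<in> bterms G \<Longrightarrow> r \<in> bterms G \<Longrightarrow>
    (Meet p (Join q r), Join (Meet p q) (Meet p r)) \<in> ba_cong G R"
| join_meet: "p \<in> bterms G \<Longrightarrow> q \<in> bterms G \<Longrightarrow> r \<in> bterms G \<Longrightarrow>
    (Join p (Meet q r), Meet (Join p q) (Join p r)) \<in> ba_cong G R"
| meet_top: "p \<in> bterms G \<Longrightarrow> (Meet p Top, p) \<in> ba_cong G R"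
| join_bot: "p \<in> bterms G \<Longrightarrow> (Join p Bot, p) \<in> ba_cong G R"
| meet_neg: "p \<in> bterms G \<Longrightarrow> (Meet p (Neg p), Bot) \<in> ba_cong G R"
| join_neg: "p \<in> bterms G \<Longrightarrow> (Join p (Neg p), Top) \<in> ba_cong G R"

definition ba_class ::
  "'g set \<Rightarrow> ('g bterm \<times> 'g bterm) set \<Rightarrow> 'g bterm \<Rightarrow> 'g bterm set" where
  "ba_class G R p = ba_cong G R `` {p}"

definition presented_ba :: "'g set \<Rightarrow> ('g bterm \<times> 'g bterm) set \<Rightarrow> 'g bterm set ba" where
  "presented_ba G R =
     \<lparr> carrier = bterms G // ba_cong G R,
       ba_meet = (\<lambda>P Q. \<Union>p\<in>P. \<Union>q\<in>Q. ba_class G R (Meet p q)),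
       ba_join = (\<lambda>P Q. \<Union>p\<in>P. \<Union>q\<in>Q. ba_class G R (Join p q)),
       ba_neg = (\<lambda>P. \<Union>p\<in>P. ba_class G R (Neg p)),
       ba_bot = ba_class G R Bot,
       ba_top = ba_class G R Top \<rparr>"

lemma bterms_simps [simp]:
  "Gen g \<in> bterms G \<longleftrightarrow> g \<in> G" "Bot \<in> bterms G" "Top \<in> bterms G"
  "Neg p \<in> bterms G \<longleftrightarrow> p \<in> bterms G"
  "Meet p q \<in> bterms G \<longleftrightarrow> p \<in> bterms G \<and> q \<in> bterms G"
  "Join p q \<in> bterms G \<longleftrightarrow> p \<in> bterms G \<and> q \<in> bterms G"
  by (auto simp: bterms_def)

lemma ba_cong_bterms: "(p, q) \<in> ba_cong G R \<Longrightarrow> p \<in> bterms G \<and> q \<in> bterms G"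
  by (induction rule: ba_cong.induct) auto

lemma equiv_ba_cong: "equiv (bterms G) (ba_cong G R)"
  by (rule equivI)
    (auto simp: refl_on_def sym_def trans_def dest: ba_cong_bterms
      intro: ba_cong.refl ba_cong.sym ba_cong.trans)

lemma ba_class_eq_iff:
  "p \<in> bterms G \<Longrightarrow> q \<in> bterms G \<Longrightarrow>
     ba_class G R p = ba_class G R q \<longleftrightarrow> (p, q) \<in> ba_cong G R"
  unfolding ba_class_def by (rule eq_equiv_class_iff[OF equiv_ba_cong])

lemma carrier_presented_ba: "carrier (presented_ba G R) = ba_class G R ` bterms G"
  by (auto simp: presented_ba_def ba_class_def quotient_def)

lemma presented_ba_bot: "ba_bot (presented_ba G R) = ba_class G R Bot"
  and presented_ba_top: "ba_top (presented_ba G R) = ba_class G R Top"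
  by (simp_all add: presented_ba_def)

lemma presented_ba_meet:
  assumes "p \<in> bterms G" "q \<in> bterms G"
  shows "ba_meet (presented_ba G R) (ba_class G R p) (ba_class G R q) = ba_class G R (Meet p q)"
proof -
  have "congruent2 (ba_cong G R) (ba_cong G R) (\<lambda>p q. ba_class G R (Meet p q))"
    by (rule congruent2I')
      (meson ba_cong.meet ba_cong_bterms ba_class_eq_iff)
  from UN_equiv_class2[OF equiv_ba_cong equiv_ba_cong this assms] show ?thesis
    by (simp add: presented_ba_def ba_class_def)
qed

lemma presented_ba_join:
  assumes "p \<in> bterms G" "q \<in> bterms G"
  shows "ba_join (presented_ba G R) (ba_class G R p) (ba_class G R q) = ba_class G R (Join p q)"
proof -
  have "congruent2 (ba_cong G R) (ba_cong G R) (\<lambda>p q. ba_class G R (Join p q))"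
    by (rule congruent2I')
      (meson ba_cong.join ba_cong_bterms ba_class_eq_iff)
  from UN_equiv_class2[OF equiv_ba_cong equiv_ba_cong this assms] show ?thesis
    by (simp add: presented_ba_def ba_class_def)
qed

lemma presented_ba_neg:
  assumes "p \<in> bterms G"
  shows "ba_neg (presented_ba G R) (ba_class G R p) = ba_class G R (Neg p)"
proof -
  have "(\<lambda>p. ba_class G R (Neg p)) respects ba_cong G R"
    by (rule congruentI)
      (meson ba_cong.neg ba_cong_bterms ba_class_eq_iff)
  from UN_equiv_class[OF equiv_ba_cong this assms] show ?thesis
    by (simp add: presented_ba_def ba_class_def)
qed

lemmas presented_ba_simps =
  presented_ba_bot presented_ba_top presented_ba_meet presented_ba_join presented_ba_neg

lemma bool_alg_presented_ba: "bool_alg (presented_ba G R)"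
  by (unfold_locales; unfold carrier_presented_ba; (elim imageE, hypsubst?)?;
      simp add: presented_ba_simps ba_class_eq_iff imageI
        ba_cong.meet_assoc ba_cong.join_assoc ba_cong.meet_comm ba_cong.join_comm
        ba_cong.meet_join ba_cong.join_meet ba_cong.meet_top ba_cong.join_bot
        ba_cong.meet_neg ba_cong.join_neg)

text \<open>
  Every assignment of the generators in a Boolean algebra that satisfies the relations factors
  through \<open>presented_ba G R\<close>.
\<close>

fun ba_eval :: "('a, 'm) ba_scheme \<Rightarrow> ('g \<Rightarrow> 'a) \<Rightarrow> 'g bterm \<Rightarrow> 'a" where
  "ba_eval C v (Gen g) = v g"
| "ba_eval C v Bot = ba_bot C"
| "ba_eval C v Top = ba_top C"
| "ba_eval C v (Neg p) = ba_neg C (ba_eval C v p)"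
| "ba_eval C v (Meet p q) = ba_meet C (ba_eval C v p) (ba_eval C v q)"
| "ba_eval C v (Join p q) = ba_join C (ba_eval C v p) (ba_eval C v q)"

lemma ba_eval_ba_cong:
  assumes C: "bool_alg C" and v: "v ` G \<subseteq> carrier C"
    and R: "\<And>p q. (p, q) \<in> R \<Longrightarrow> ba_eval C v p = ba_eval C v q"
    and pq: "(p, q) \<in> ba_cong G R"
  shows "ba_eval C v p = ba_eval C v q"
proof -
  interpret bool_alg C by fact
  have cl: "ba_eval C v p \<in> carrier C" if "p \<in> bterms G" for p
    using that v by (induction p) (auto intro: meet_closed join_closed neg_closed bot_closed top_closed)
  from pq show ?thesis
    by (induction rule: ba_cong.induct)
      (simp_all add: R cl meet_assoc join_assoc meet_join_distrib join_meet_distrib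
        meet_top join_bot meet_neg join_neg meet_comm[OF cl cl] join_comm[OF cl cl])
qed


section \<open>The algebras \<open>\<B>\<^sub>k\<close>\<close>

datatype gen = S nat | T nat

definition Joins :: "'g bterm list \<Rightarrow> 'g bterm" where
  "Joins ps = foldr Join ps Bot"

text \<open>An inequality \<open>p \<le> q\<close> is the relation \<open>p \<and> q = p\<close>.\<close>

definition le_rel :: "'g bterm \<Rightarrow> 'g bterm \<Rightarrow> 'g bterm \<times> 'g bterm" where
  "le_rel p q = (Meet p q, p)"

definition Bk_gens :: "nat \<Rightarrow> gen set" where
  "Bk_gens k = S ` {0..k} \<union> T ` {0..k}"

definition Bk_rels :: "nat \<Rightarrow> (gen bterm \<times> gen bterm) set" where
  "Bk_rels k =
     {(Gen (S 0), Bot)}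
     \<union> {le_rel (Gen (S i)) (Gen (T i)) | i. i \<le> k}
     \<union> {le_rel (Gen (T 0)) (Join (Joins (map (\<lambda>j. Gen (S j)) [1..<Suc i])) (Gen (T (Suc i)))) | i. i < k}
     \<union> {le_rel (Gen (T 0)) (Joins (map (\<lambda>j. Gen (S j)) [1..<Suc k]))}"

definition Bk :: "nat \<Rightarrow> gen bterm set ba" where
  "Bk k = presented_ba (Bk_gens k) (Bk_rels k)"

definition Bk_s :: "nat \<Rightarrow> nat \<Rightarrow> gen bterm set" where
  "Bk_s k i = ba_class (Bk_gens k) (Bk_rels k) (Gen (S i))"

definition Bk_t :: "nat \<Rightarrow> nat \<Rightarrow> gen bterm set" where
  "Bk_t k i = ba_class (Bk_gens k) (Bk_rels k) (Gen (T i))"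

lemma Bk_rels_subset: "Bk_rels k \<subseteq> bterms (Bk_gens k) \<times> bterms (Bk_gens k)"
proof -
  have "Joins ps \<in> bterms G \<longleftrightarrow> set ps \<subseteq> bterms G" for ps and G :: "gen set"
    by (induction ps) (auto simp: Joins_def)
  then show ?thesis
    by (auto simp: Bk_rels_def Bk_gens_def le_rel_def)
qed

lemma Bk_interval_mem:
  assumes "i \<le> k"
  shows "(Bk_s k i, Bk_t k i) \<in> interval_algebra (Bk k)"
proof -
  have st: "S i \<in> Bk_gens k" "T i \<in> Bk_gens k"
    using assms by (auto simp: Bk_gens_def)
  have "(Meet (Gen (S i)) (Gen (T i)), Gen (S i)) \<in> ba_cong (Bk_gens k) (Bk_rels k)"
    using assms st by (intro ba_cong.rel) (auto simp: Bk_rels_def le_rel_def)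
  with st show ?thesis
    by (simp add: interval_algebra_def ba_le_def Bk_def Bk_s_def Bk_t_def
        carrier_presented_ba presented_ba_meet ba_class_eq_iff)
qed


section \<open>The union of the localizations\<close>

definition \<L>_union :: "nat \<Rightarrow> (gen bterm set \<times> gen bterm set) set" where
  "\<L>_union k = (\<Union>i\<in>{0..k}. localization (Bk k) (Bk_s k i, Bk_t k i))"

definition \<Phi> :: "nat \<Rightarrow> nat \<Rightarrow> real" where
  "\<Phi> k l = 3 ^ k * (2 / 3) ^ l"

end

theory Submission
  imports Defs "HOL-Library.FuncSet"
begin

text \<open>
  A finitely presented Boolean algebra is the power set of its models, the two-valued
  assignments that satisfy the relations: minterms show that a class is determined by the
  models in which it holds (\<open>completeness\<close>), and joins of minterms realise every set of models.
  In \<open>\<B>\<^sub>k\<close> an interval is therefore a pair \<open>P \<subseteq> Q\<close> of sets of models, or a choice, at every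
  model, of one of the three intervals \<open>[0,0]\<close>, \<open>[0,1]\<close>, \<open>[1,1]\<close> of the two-element algebra.

  The localization at \<open>[s,t]\<close> consists of the intervals that are \<open>[0,1]\<close> at every model where
  \<open>[s,t]\<close> is, and are arbitrary at the others (\<open>mem_localization_iff\<close>). Hence the intersection
  of the localizations with indices in \<open>I\<close> has \<open>3 ^ N\<close> elements, where \<open>N\<close> counts the models in
  which no \<open>[s\<^sub>i,t\<^sub>i]\<close> with \<open>i \<in> I\<close> is \<open>[0,1]\<close>, and the union is counted by inclusion and
  exclusion.

  It remains to see that \<open>N\<close> depends only on \<open>n = card I > 0\<close>. The relations look asymmetric in
  the index \<open>0\<close>, but this is only a normalisation. Record the value of \<open>[s\<^sub>i,t\<^sub>i]\<close> as a sign: \<open>0\<close> for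
  \<open>[0,1]\<close>, and \<open>-1\<close>, \<open>1\<close> for \<open>[0,0]\<close>, \<open>[1,1]\<close>, with the signs interchanged at index \<open>0\<close>, where
  \<open>[1,1]\<close> is impossible. If \<open>t\<^sub>0 = 0\<close>, then the other coordinates are free; if \<open>t\<^sub>0 = 1\<close>, then the
  relations say that some \<open>s\<^sub>i\<close> is \<open>1\<close> and that every interval before the first such \<open>i\<close> is \<open>[0,1]\<close>. In both cases
  the models are exactly the vectors in \<open>{-1,0,1}\<^sup>k\<^sup>+\<^sup>1\<close> whose first nonzero entry is \<open>1\<close>
  (\<open>bij_betw_sign_vector\<close>), that is, the nonzero vectors up to negation. Those without a zero in
  \<open>I\<close> number \<open>2 ^ n * 3 ^ (k + 1 - n) / 2\<close>, which is \<open>\<Phi> k (n - 1)\<close>.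
\<close>

section \<open>Minterms in a Boolean algebra\<close>

definition two_ba :: "bool ba" where
  "two_ba = \<lparr>carrier = UNIV, ba_meet = (\<and>), ba_join = (\<or>), ba_neg = Not,
     ba_bot = False, ba_top = True\<rparr>"

lemma bool_alg_two_ba: "bool_alg two_ba"
  by unfold_locales (auto simp: two_ba_def)

definition holds :: "'g set \<Rightarrow> 'g bterm \<Rightarrow> bool" where
  "holds v p = ba_eval two_ba (\<lambda>g. g \<in> v) p"

lemma holds_simps [simp]:
  "holds v (Gen g) \<longleftrightarrow> g \<in> v" "\<not> holds v Bot" "holds v Top"
  "holds v (Neg p) \<longleftrightarrow> \<not> holds v p"
  "holds v (Meet p q) \<longleftrightarrow> holds v p \<and> holds v q"
  "holds v (Join p q) \<longleftrightarrow> holds v p \<or> holds v q"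
  by (simp_all add: holds_def two_ba_def)

lemma holds_Joins [simp]: "holds v (Joins ps) \<longleftrightarrow> (\<exists>p\<in>set ps. holds v p)"
  by (induction ps) (simp_all add: Joins_def)

lemma Joins_in_bterms [simp]: "Joins ps \<in> bterms G \<longleftrightarrow> set ps \<subseteq> bterms G"
  by (induction ps) (simp_all add: Joins_def)

text \<open>
  The generators come as a list because \<open>Meet\<close> is binary and, on terms, not commutative.
\<close>

primrec minterm :: "'g list \<Rightarrow> 'g set \<Rightarrow> 'g bterm" where
  "minterm [] v = Top"
| "minterm (g # gs) v = Meet (if g \<in> v then Gen g else Neg (Gen g)) (minterm gs v)"

lemma minterm_in_bterms: "set gs \<subseteq> G \<Longrightarrow> minterm gs v \<in> bterms G"
  by (induction gs) auto

lemma holds_minterm: "holds w (minterm gs v) \<longleftrightarrow> (\<forall>g\<in>set gs. g \<in> w \<longleftrightarrow> g \<in> v)"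
  by (induction gs) auto

lemma minterm_cong: "(\<And>g. g \<in> set gs \<Longrightarrow> g \<in> v \<longleftrightarrow> g \<in> w) \<Longrightarrow> minterm gs v = minterm gs w"
  by (induction gs) auto

context bool_alg
begin

lemma ba_eval_closed: "a ` G \<subseteq> carrier B \<Longrightarrow> p \<in> bterms G \<Longrightarrow> ba_eval B a p \<in> carrier B"
  by (induction p) (auto intro: meet_closed join_closed neg_closed bot_closed top_closed)

lemma join_idem:
  assumes x: "x \<in> carrier B" shows "ba_join B x x = x"
proof -
  have "ba_join B x x = ba_meet B (ba_join B x x) (ba_join B x (ba_neg B x))"
    using x by (simp add: join_neg meet_top join_closed)
  also have "\<dots> = ba_join B x (ba_meet B x (ba_neg B x))"
    using x by (simp add: join_meet_distrib neg_closed)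
  also have "\<dots> = x" using x by (simp add: meet_neg join_bot)
  finally show ?thesis .
qed

lemma meet_idem:
  assumes x: "x \<in> carrier B" shows "ba_meet B x x = x"
proof -
  have "ba_meet B x x = ba_join B (ba_meet B x x) (ba_meet B x (ba_neg B x))"
    using x by (simp add: meet_neg join_bot meet_closed)
  also have "\<dots> = ba_meet B x (ba_join B x (ba_neg B x))"
    using x by (simp add: meet_join_distrib neg_closed)
  also have "\<dots> = x" using x by (simp add: join_neg meet_top)
  finally show ?thesis .
qed

lemma bot_meet:
  assumes x: "x \<in> carrier B" shows "ba_meet B (ba_bot B) x = ba_bot B"
proof -
  have "ba_meet B (ba_bot B) x = ba_meet B x (ba_meet B x (ba_neg B x))"
    using x by (simp add: meet_neg meet_comm[OF bot_closed])
  also have "\<dots> = ba_meet B (ba_meet B x x) (ba_neg B x)"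
    using x by (simp add: meet_assoc neg_closed)
  also have "\<dots> = ba_bot B" using x by (simp add: meet_idem meet_neg)
  finally show ?thesis .
qed

lemma split_by:
  assumes c: "c \<in> carrier B" and x: "x \<in> carrier B"
  shows "ba_join B (ba_meet B x c) (ba_meet B x (ba_neg B c)) = x"
  using assms by (simp add: meet_join_distrib[symmetric] neg_closed join_neg meet_top)

lemma eq_by_cases:
  assumes "c \<in> carrier B" "x \<in> carrier B" "y \<in> carrier B"
    and "ba_meet B x c = ba_meet B y c" "ba_meet B x (ba_neg B c) = ba_meet B y (ba_neg B c)"
  shows "x = y"
proof -
  have "x = ba_join B (ba_meet B x c) (ba_meet B x (ba_neg B c))"
    by (rule split_by[OF assms(1,2), symmetric])
  also have "\<dots> = ba_join B (ba_meet B y c) (ba_meet B y (ba_neg B c))"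
    by (simp only: assms(4,5))
  also have "\<dots> = y" by (rule split_by[OF assms(1,3)])
  finally show ?thesis .
qed

text \<open>
  The minterms cover the top element. Splitting on one generator at a time avoids forming their
  join: \<open>x\<close> and \<open>y\<close> agree below \<open>g\<close> and below its complement, each time by induction.
\<close>

lemma eq_by_minterms:
  assumes "distinct gs" "a ` set gs \<subseteq> carrier B" "x \<in> carrier B" "y \<in> carrier B"
    and "\<And>v. v \<subseteq> set gs \<Longrightarrow>
      ba_meet B (ba_eval B a (minterm gs v)) x = ba_meet B (ba_eval B a (minterm gs v)) y"
  shows "x = y"
  using assms
proof (induction gs arbitrary: x y)
  case Nil
  then have "ba_meet B (ba_top B) x = ba_meet B (ba_top B) y" by simp
  then show ?case using Nil.prems by (simp add: meet_top meet_comm[OF top_closed])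
next
  case (Cons g gs)
  have g: "a g \<in> carrier B" and gs: "a ` set gs \<subseteq> carrier B" using Cons.prems by auto
  have m: "ba_eval B a (minterm gs v) \<in> carrier B" for v
    by (rule ba_eval_closed[OF gs]) (rule minterm_in_bterms, simp)
  have reassoc: "ba_meet B z (ba_meet B c u) = ba_meet B (ba_meet B c z) u"
    if "c \<in> carrier B" "z \<in> carrier B" "u \<in> carrier B" for c z u
    using that by (simp add: meet_assoc[symmetric] meet_comm[of z c])
  have step: "ba_meet B c x = ba_meet B c y"
    if c: "c = (if b then a g else ba_neg B (a g))" for b c
  proof (rule Cons.IH[OF _ gs])
    show "distinct gs" using Cons.prems by simp
    have cB: "c \<in> carrier B" using c g neg_closed by auto
    show "ba_meet B c x \<in> carrier B" "ba_meet B c y \<in> carrier B"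
      using Cons.prems cB meet_closed by auto
    fix v assume v: "v \<subseteq> set gs"
    define w where "w = (if b then insert g v else v)"
    have "g \<notin> v" using v Cons.prems(1) by auto
    then have "ba_eval B a (minterm (g # gs) w) = ba_meet B c (ba_eval B a (minterm gs w))"
      by (simp add: c w_def)
    moreover have "minterm gs w = minterm gs v"
      using Cons.prems(1) by (intro minterm_cong) (auto simp: w_def)
    moreover have "w \<subseteq> set (g # gs)" using v by (auto simp: w_def)
    ultimately show "ba_meet B (ba_eval B a (minterm gs v)) (ba_meet B c x)
        = ba_meet B (ba_eval B a (minterm gs v)) (ba_meet B c y)"
      using Cons.prems(5)[of w] by (simp add: reassoc[OF cB m] Cons.prems)
  qed
  show ?case
    by (rule eq_by_cases[OF g])
      (use Cons.prems g step[of _ True] step[of _ False] in \<open>auto simp: meet_comm[OF _ g] meet_comm[OF _ neg_closed[OF g]]\<close>)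
qed

text \<open>
  A minterm lies below every generator or below its complement, so it is an atom or zero in the
  subalgebra generated by \<open>gs\<close>.
\<close>

lemma minterm_decides:
  assumes a: "a ` set gs \<subseteq> carrier B" and p: "p \<in> bterms (set gs)"
  shows "ba_meet B (ba_eval B a (minterm gs v)) (ba_eval B a p)
    = (if holds v p then ba_eval B a (minterm gs v) else ba_bot B)"
proof -
  have mB: "ba_eval B a (minterm gs v) \<in> carrier B"
    by (rule ba_eval_closed[OF a]) (rule minterm_in_bterms, simp)
  have eB: "ba_eval B a q \<in> carrier B" if "q \<in> bterms (set gs)" for q
    by (rule ba_eval_closed[OF a that])
  define m where "m = ba_eval B a (minterm gs v)"
  note m = mB[folded m_def]
  have "ba_meet B m (ba_eval B a p) = (if holds v p then m else ba_bot B)"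
    using p
  proof (induction p)
    case (Gen g)
    have "g \<in> set gs \<Longrightarrow> a ` set gs \<subseteq> carrier B \<Longrightarrow> ba_meet B (ba_eval B a (minterm gs v)) (a g)
      = (if g \<in> v then ba_eval B a (minterm gs v) else ba_bot B)"
    proof (induction gs)
      case (Cons h gs)
      define c where "c = (if h \<in> v then a h else ba_neg B (a h))"
      define n where "n = ba_eval B a (minterm gs v)"
      have c: "c \<in> carrier B" using Cons.prems neg_closed by (auto simp: c_def)
      have n: "n \<in> carrier B"
        unfolding n_def by (rule ba_eval_closed[of _ "set gs"]) (use Cons.prems in \<open>auto intro: minterm_in_bterms\<close>)
      have g: "a g \<in> carrier B" using Cons.prems by auto
      have e: "ba_eval B a (minterm (h # gs) v) = ba_meet B c n"
        by (simp add: c_def n_def)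
      show ?case
      proof (cases "g = h")
        case True
        have "ba_meet B c (a g) = (if g \<in> v then c else ba_bot B)"
          using g True by (simp add: c_def meet_idem meet_comm[OF neg_closed] meet_neg)
        moreover have "ba_meet B (ba_meet B c n) (a g) = ba_meet B (ba_meet B c (a g)) n"
          using c n g by (simp add: meet_assoc meet_comm[of n])
        ultimately show ?thesis unfolding e using n by (simp add: bot_meet)
      next
        case False
        then have "ba_meet B n (a g) = (if g \<in> v then n else ba_bot B)"
          using Cons unfolding n_def by simp
        then show ?thesis unfolding e using c n g
          by (simp add: meet_assoc bot_meet meet_comm[OF c bot_closed])
      qed
    qed simp
    with Gen a show ?case by (simp add: m_def)
  next
    case Bot
    then show ?case using m by (simp add: bot_meet meet_comm[OF m bot_closed])
  next
    case Top
    then show ?case using m by (simp add: meet_top)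
  next
    case (Neg p)
    then have pB: "ba_eval B a p \<in> carrier B" using eB by simp
    have "ba_meet B m (ba_neg B (ba_eval B a p)) = ba_bot B" if "ba_meet B m (ba_eval B a p) = m"
    proof -
      have "ba_meet B m (ba_neg B (ba_eval B a p))
          = ba_meet B m (ba_meet B (ba_eval B a p) (ba_neg B (ba_eval B a p)))"
        using that pB m by (metis meet_assoc neg_closed)
      then show ?thesis using pB m by (simp add: meet_neg meet_comm[OF _ bot_closed] bot_meet)
    qed
    moreover have "ba_meet B m (ba_neg B (ba_eval B a p)) = m"
      if "ba_meet B m (ba_eval B a p) = ba_bot B"
      using split_by[OF pB m] that pB m
      by (simp add: join_comm[OF bot_closed] join_bot meet_closed neg_closed)
    ultimately show ?case using Neg by auto
  next
    case (Meet p q)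
    then have "ba_eval B a p \<in> carrier B" "ba_eval B a q \<in> carrier B" using eB by auto
    then have "ba_meet B m (ba_eval B a (Meet p q)) = ba_meet B (ba_meet B m (ba_eval B a p)) (ba_eval B a q)"
      using m by (simp add: meet_assoc)
    with Meet eB show ?case by (simp add: bot_meet)
  next
    case (Join p q)
    then have "ba_eval B a p \<in> carrier B" "ba_eval B a q \<in> carrier B" using eB by auto
    then have "ba_meet B m (ba_eval B a (Join p q))
        = ba_join B (ba_meet B m (ba_eval B a p)) (ba_meet B m (ba_eval B a q))"
      using m by (simp add: meet_join_distrib)
    with Join m show ?case
      by (auto simp: join_idem join_bot bot_closed join_comm[OF bot_closed m])
  qed
  then show ?thesis by (simp add: m_def)
qed

end

section \<open>Finitely presented Boolean algebras are power sets of models\<close>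

locale set_representation = bool_alg B for B :: "('a, 'm) ba_scheme" +
  fixes V :: "'v set" and ext :: "'a \<Rightarrow> 'v set"
  assumes bij_ext: "bij_betw ext (carrier B) (Pow V)"
    and ext_meet: "x \<in> carrier B \<Longrightarrow> y \<in> carrier B \<Longrightarrow> ext (ba_meet B x y) = ext x \<inter> ext y"
    and ext_join: "x \<in> carrier B \<Longrightarrow> y \<in> carrier B \<Longrightarrow> ext (ba_join B x y) = ext x \<union> ext y"
    and ext_neg: "x \<in> carrier B \<Longrightarrow> ext (ba_neg B x) = V - ext x"

text \<open>
  Two-valued assignments are given by the set of generators that are true; requiring
  \<open>v \<subseteq> G\<close> keeps assignments apart only if they differ on \<open>G\<close>.
\<close>

definition models :: "'g set \<Rightarrow> ('g bterm \<times> 'g bterm) set \<Rightarrow> 'g set set" where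
  "models G R = {v. v \<subseteq> G \<and> (\<forall>(p, q)\<in>R. holds v p \<longleftrightarrow> holds v q)}"

definition extension :: "'g set \<Rightarrow> ('g bterm \<times> 'g bterm) set \<Rightarrow> 'g bterm set \<Rightarrow> 'g set set" where
  "extension G R P = {v \<in> models G R. \<exists>p\<in>P. holds v p}"

lemma soundness:
  assumes "v \<in> models G R" and "(p, q) \<in> ba_cong G R"
  shows "holds v p \<longleftrightarrow> holds v q"
  unfolding holds_def
  by (rule ba_eval_ba_cong[OF bool_alg_two_ba _ _ assms(2)])
    (use assms(1) in \<open>auto simp: two_ba_def models_def holds_def split: prod.splits\<close>)

lemma extension_class:
  assumes "p \<in> bterms G"
  shows "extension G R (ba_class G R p) = {v \<in> models G R. holds v p}"
  using assms by (auto simp: extension_def ba_class_def soundness intro: ba_cong.refl)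

lemma ba_class_eq_eval:
  assumes "p \<in> bterms G"
  shows "ba_class G R p = ba_eval (presented_ba G R) (\<lambda>g. ba_class G R (Gen g)) p"
  using assms by (induction p) (simp_all add: presented_ba_simps[symmetric])

text \<open>
  If \<open>v\<close> violates a relation, then the minterm of \<open>v\<close> lies below one side and below the
  complement of the other, hence is zero in the quotient. The remaining minterms come from
  models, and there \<open>p\<close> and \<open>q\<close> agree.
\<close>

lemma completeness:
  assumes G: "finite G" and R: "R \<subseteq> bterms G \<times> bterms G"
    and p: "p \<in> bterms G" and q: "q \<in> bterms G"
    and eq: "\<And>v. v \<in> models G R \<Longrightarrow> holds v p \<longleftrightarrow> holds v q"
  shows "ba_class G R p = ba_class G R q"
proof -
  interpret bool_alg "presented_ba G R" by (rule bool_alg_presented_ba)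
  obtain gs where gs: "set gs = G" "distinct gs" using finite_distinct_list[OF G] by auto
  let ?B = "presented_ba G R" and ?c = "ba_class G R"
  let ?a = "\<lambda>g. ?c (Gen g)"
  have a: "?a ` set gs \<subseteq> carrier ?B" by (auto simp: gs carrier_presented_ba)
  have cB: "?c r \<in> carrier ?B" if "r \<in> bterms G" for r
    using that by (simp add: carrier_presented_ba)
  have dec: "ba_meet ?B (ba_eval ?B ?a (minterm gs v)) (?c r)
      = (if holds v r then ba_eval ?B ?a (minterm gs v) else ba_bot ?B)" if "r \<in> bterms G" for r v
    using minterm_decides[OF a, of r v] that by (simp add: gs ba_class_eq_eval)
  show ?thesis
  proof (rule eq_by_minterms[OF gs(2) a cB[OF p] cB[OF q]])
    fix v assume v: "v \<subseteq> set gs"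
    show "ba_meet ?B (ba_eval ?B ?a (minterm gs v)) (?c p)
        = ba_meet ?B (ba_eval ?B ?a (minterm gs v)) (?c q)"
    proof (cases "v \<in> models G R")
      case True
      then show ?thesis using eq by (simp add: dec p q)
    next
      case False
      then obtain r r' where r: "(r, r') \<in> R" "holds v r \<noteq> holds v r'"
        using v gs by (auto simp: models_def)
      with R have rG: "r \<in> bterms G" "r' \<in> bterms G" by auto
      then have "?c r = ?c r'" using r(1) by (simp add: ba_class_eq_iff ba_cong.rel)
      then have "ba_eval ?B ?a (minterm gs v) = ba_bot ?B"
        using dec[OF rG(1), of v] dec[OF rG(2), of v] r(2) by (auto split: if_splits)
      then show ?thesis by (simp add: bot_meet cB p q)
    qed
  qed
qed

lemma finite_models: "finite G \<Longrightarrow> finite (models G R)"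
  by (rule finite_subset[of _ "Pow G"]) (auto simp: models_def)

lemma set_representation_presented_ba:
  assumes G: "finite G" and R: "R \<subseteq> bterms G \<times> bterms G"
  shows "set_representation (presented_ba G R) (models G R) (extension G R)"
proof -
  interpret bool_alg "presented_ba G R" by (rule bool_alg_presented_ba)
  obtain gs where gs: "set gs = G" using finite_list[OF G] by auto
  have inj: "inj_on (extension G R) (carrier (presented_ba G R))"
  proof (rule inj_onI, unfold carrier_presented_ba, elim imageE, hypsubst)
    fix p q assume pq: "p \<in> bterms G" "q \<in> bterms G"
      and "extension G R (ba_class G R p) = extension G R (ba_class G R q)"
    then have "{v \<in> models G R. holds v p} = {v \<in> models G R. holds v q}"
      by (simp add: extension_class)
    then show "ba_class G R p = ba_class G R q"
      by (intro completeness[OF G R pq]) blast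
  qed
  have "U \<in> extension G R ` carrier (presented_ba G R)" if U: "U \<subseteq> models G R" for U
  proof -
    obtain vs where vs: "set vs = U"
      using finite_list[OF finite_subset[OF U finite_models[OF G]]] by auto
    define p where "p = Joins (map (minterm gs) vs)"
    have p: "p \<in> bterms G" by (auto simp: p_def gs intro: minterm_in_bterms)
    have "holds w p \<longleftrightarrow> w \<in> U" if "w \<in> models G R" for w
    proof -
      have "holds w p \<longleftrightarrow> (\<exists>v\<in>U. \<forall>g\<in>G. g \<in> w \<longleftrightarrow> g \<in> v)"
        by (simp add: p_def holds_minterm vs gs)
      also have "\<dots> \<longleftrightarrow> (\<exists>v\<in>U. w = v)"
      proof (rule bex_cong[OF HOL.refl])
        fix v assume "v \<in> U"
        then have "v \<subseteq> G" "w \<subseteq> G" using that U by (auto simp: models_def)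
        then show "(\<forall>g\<in>G. g \<in> w \<longleftrightarrow> g \<in> v) \<longleftrightarrow> w = v" by blast
      qed
      finally show ?thesis by simp
    qed
    then have "extension G R (ba_class G R p) = U"
      using U by (auto simp: extension_class[OF p])
    then show ?thesis using p by (auto simp: carrier_presented_ba)
  qed
  then have "extension G R ` carrier (presented_ba G R) = Pow (models G R)"
    by (auto simp: extension_def)
  with inj have "bij_betw (extension G R) (carrier (presented_ba G R)) (Pow (models G R))"
    by (simp add: bij_betw_def)
  then show ?thesis
    by unfold_locales
      (auto simp: carrier_presented_ba presented_ba_simps extension_class)
qed

section \<open>Localizations as sets of intervals of sets\<close>

text \<open>
  Outside \<open>D\<close> every point has three choices: in neither set, in \<open>Q\<close> only, or in both.
\<close>

lemma card_set_intervals: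
  assumes V: "finite V" and D: "D \<subseteq> V"
  shows "card {(P, Q). P \<subseteq> Q \<and> Q \<subseteq> V \<and> D \<subseteq> Q - P} = 3 ^ card (V - D)"
proof -
  let ?A = "{(P, Q). P \<subseteq> Q \<and> Q \<subseteq> V \<and> D \<subseteq> Q - P}"
  let ?F = "V - D \<rightarrow>\<^sub>E {(False, False), (False, True), (True, True)}"
  let ?h = "\<lambda>(P, Q). \<lambda>v\<in>V - D. (v \<in> P, v \<in> Q)"
  let ?g = "\<lambda>f. ({v \<in> V - D. fst (f v)}, D \<union> {v \<in> V - D. snd (f v)})"
  have "bij_betw ?h ?A ?F"
  proof (rule bij_betw_byWitness[where f' = ?g])
    show "\<forall>x\<in>?A. ?g (?h x) = x" using D by auto
    show "\<forall>f\<in>?F. ?h (?g f) = f"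
    proof (intro ballI ext)
      fix f v assume "f \<in> ?F"
      then show "?h (?g f) v = f v" by (cases "v \<in> V - D") (auto simp: PiE_arb[of f])
    qed
    show "?h ` ?A \<subseteq> ?F" 
    proof (rule image_subsetI)
      fix x assume "x \<in> ?A"
      then show "?h x \<in> ?F" unfolding PiE_iff by auto
    qed
    show "?g ` ?F \<subseteq> ?A"
    proof (intro image_subsetI)
      fix f assume "f \<in> ?F"
      then have "f v \<in> {(False, False), (False, True), (True, True)}" if "v \<in> V - D" for v
        using that by (rule PiE_mem)
      then have "fst (f v) \<Longrightarrow> snd (f v)" if "v \<in> V - D" for v using that by fastforce
      then show "?g f \<in> ?A" using D by auto
    qed
  qed
  then have "card ?A = card ?F" by (rule bij_betw_same_card)
  also have "\<dots> = 3 ^ card (V - D)" using V by (simp add: card_funcsetE numeral_3_eq_3)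
  finally show ?thesis .
qed

context set_representation
begin

lemma ext_subset: "x \<in> carrier B \<Longrightarrow> ext x \<subseteq> V"
  using bij_ext by (auto simp: bij_betw_def)

lemma ext_eq_iff: "x \<in> carrier B \<Longrightarrow> y \<in> carrier B \<Longrightarrow> ext x = ext y \<longleftrightarrow> x = y"
  using bij_ext by (auto simp: bij_betw_def inj_on_def)

lemma ba_le_iff: "x \<in> carrier B \<Longrightarrow> y \<in> carrier B \<Longrightarrow> ba_le B x y \<longleftrightarrow> ext x \<subseteq> ext y"
  by (subst ext_eq_iff[symmetric, of "ba_meet B x y" x] | simp add: ba_le_def meet_closed)+
    (auto simp: ext_meet)

text \<open>
  Pointwise, \<open>\<Delta>(y,x)\<close> reflects \<open>x\<close> inside \<open>y\<close>: it swaps \<open>[0,0]\<close> and \<open>[1,1]\<close> where \<open>y\<close> is \<open>[0,1]\<close>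
  and is \<open>x\<close> elsewhere. Where \<open>[s,t]\<close> is \<open>[0,1]\<close>, so are \<open>x\<close> and \<open>y\<close>, and nothing changes; where
  \<open>[s,t]\<close> is a single point, each of the three intervals occurs.
\<close>

lemma mem_localization_iff:
  assumes s: "s \<in> carrier B" and t: "t \<in> carrier B" and st: "ext s \<subseteq> ext t"
  shows "(p, q) \<in> localization B (s, t) \<longleftrightarrow>
    p \<in> carrier B \<and> q \<in> carrier B \<and> ext p \<subseteq> ext q \<and> ext t - ext s \<subseteq> ext q - ext p"
proof
  assume "(p, q) \<in> localization B (s, t)"
  then obtain c d a b where ab: "a \<in> carrier B" "b \<in> carrier B" "ba_le B a b"
    and cd: "c \<in> carrier B" "d \<in> carrier B" "ba_le B c d"
    and le: "ba_le B c s" "ba_le B t d" "ba_le B a c" "ba_le B d b"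
    and p: "p = ba_join B a (ba_meet B b (ba_neg B d))"
    and q: "q = ba_meet B b (ba_join B a (ba_neg B c))"
    by (auto simp: localization_def interval_algebra_def interval_le_def)
  have "ext p = ext a \<union> (ext b \<inter> (V - ext d))" "ext q = ext b \<inter> (ext a \<union> (V - ext c))"
    using ab cd by (simp_all add: p q ext_meet ext_join ext_neg meet_closed join_closed neg_closed)
  moreover have "p \<in> carrier B" "q \<in> carrier B"
    using ab cd by (simp_all add: p q meet_closed join_closed neg_closed)
  moreover have "ext c \<subseteq> ext s" "ext t \<subseteq> ext d" "ext a \<subseteq> ext c" "ext d \<subseteq> ext b" "ext c \<subseteq> ext d"
    using ab cd le s t by (simp_all add: ba_le_iff)
  moreover have "ext b \<subseteq> V" using ab ext_subset by auto
  ultimately show "p \<in> carrier B \<and> q \<in> carrier B \<and> ext p \<subseteq> ext q \<and> ext t - ext s \<subseteq> ext q - ext p"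
    by blast
next
  assume "p \<in> carrier B \<and> q \<in> carrier B \<and> ext p \<subseteq> ext q \<and> ext t - ext s \<subseteq> ext q - ext p"
  then have pq: "p \<in> carrier B" "q \<in> carrier B" and sub: "ext p \<subseteq> ext q" "ext t - ext s \<subseteq> ext q - ext p"
    by auto
  \<comment> \<open>The outer interval is the join of \<open>[s,t]\<close> and \<open>[p,q]\<close>; as reflection in it is an involution,
    the inner one has to be the reflection of \<open>[p,q]\<close>.\<close>
  define a b where "a = ba_meet B s p" and "b = ba_join B t q"
  define c d where "c = ba_join B a (ba_meet B b (ba_neg B q))"
    and "d = ba_meet B b (ba_join B a (ba_neg B p))"
  have ab: "a \<in> carrier B" "b \<in> carrier B"
    using s t pq by (simp_all add: a_def b_def meet_closed join_closed)
  have cd: "c \<in> carrier B" "d \<in> carrier B"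
    using ab pq by (simp_all add: c_def d_def meet_closed join_closed neg_closed)
  have ext_ab: "ext a = ext s \<inter> ext p" "ext b = ext t \<union> ext q"
    using s t pq by (simp_all add: a_def b_def ext_meet ext_join)
  have ext_cd: "ext c = ext a \<union> (ext b \<inter> (V - ext q))" "ext d = ext b \<inter> (ext a \<union> (V - ext p))"
    using ab pq by (simp_all add: c_def d_def ext_meet ext_join ext_neg meet_closed join_closed neg_closed)
  have V: "ext s \<subseteq> V" "ext t \<subseteq> V" "ext p \<subseteq> V" "ext q \<subseteq> V" using s t pq ext_subset by auto
  have le: "ba_le B a b" "ba_le B c d" "ba_le B c s" "ba_le B t d" "ba_le B a c" "ba_le B d b"
    using ab cd s t sub st V by (simp_all add: ba_le_iff ext_cd ext_ab) blast+
  have "p = ba_join B a (ba_meet B b (ba_neg B d))"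
    using ab cd pq sub V st
    by (subst ext_eq_iff[symmetric])
      (simp_all add: ext_meet ext_join ext_neg meet_closed join_closed neg_closed ext_cd ext_ab, blast)
  moreover have "q = ba_meet B b (ba_join B a (ba_neg B c))"
    using ab cd pq sub V st
    by (subst ext_eq_iff[symmetric])
      (simp_all add: ext_meet ext_join ext_neg meet_closed join_closed neg_closed ext_cd ext_ab, blast)
  ultimately have "(p, q) = interval_Delta B (a, b) (c, d)" by simp
  moreover have "(a, b) \<in> interval_algebra B" "(c, d) \<in> interval_algebra B"
    "interval_le B (s, t) (c, d)" "interval_le B (c, d) (a, b)"
    using ab cd le by (simp_all add: interval_algebra_def interval_le_def)
  ultimately show "(p, q) \<in> localization B (s, t)"
    unfolding localization_def by blast
qed

lemma card_Inter_localizations: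
  assumes V: "finite V" and I: "I \<noteq> {}"
    and s: "\<And>i. i \<in> I \<Longrightarrow> s i \<in> carrier B" and t: "\<And>i. i \<in> I \<Longrightarrow> t i \<in> carrier B"
    and st: "\<And>i. i \<in> I \<Longrightarrow> ext (s i) \<subseteq> ext (t i)"
  shows "card (\<Inter>i\<in>I. localization B (s i, t i)) = 3 ^ card (V - (\<Union>i\<in>I. ext (t i) - ext (s i)))"
proof -
  define D where "D = (\<Union>i\<in>I. ext (t i) - ext (s i))"
  define L where "L = (\<Inter>i\<in>I. localization B (s i, t i))"
  let ?A = "{(P, Q). P \<subseteq> Q \<and> Q \<subseteq> V \<and> D \<subseteq> Q - P}"
  have D: "D \<subseteq> V" using t ext_subset unfolding D_def by blast
  have mem: "x \<in> L \<longleftrightarrow> fst x \<in> carrier B \<and> snd x \<in> carrier B \<and>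
      ext (fst x) \<subseteq> ext (snd x) \<and> D \<subseteq> ext (snd x) - ext (fst x)" for x
    using I mem_localization_iff[OF s t st] unfolding D_def L_def by (cases x) (simp, blast)
  have "bij_betw (map_prod ext ext) L ?A"
    unfolding bij_betw_def
  proof
    show "inj_on (map_prod ext ext) L"
    proof (rule inj_onI)
      fix x y assume "x \<in> L" "y \<in> L" "map_prod ext ext x = map_prod ext ext y"
      then show "x = y" unfolding mem by (cases x; cases y) (auto simp: ext_eq_iff)
    qed
    show "map_prod ext ext ` L = ?A"
    proof (intro equalityI subsetI)
      fix y assume "y \<in> map_prod ext ext ` L"
      then obtain x where x: "x \<in> L" "y = map_prod ext ext x" by (rule imageE)
      with ext_subset[of "snd x"] show "y \<in> ?A" by (cases x) (simp add: mem)
    next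
      fix y assume "y \<in> ?A"
      then obtain P Q where y: "y = (P, Q)" "P \<subseteq> Q" "Q \<subseteq> V" "D \<subseteq> Q - P" by blast
      then have "P \<in> Pow V" "Q \<in> Pow V" by auto
      then obtain p q where "p \<in> carrier B" "q \<in> carrier B" "P = ext p" "Q = ext q"
        using bij_ext by (metis bij_betw_imp_surj_on imageE)
      with y have "(p, q) \<in> L" "y = map_prod ext ext (p, q)"
        unfolding mem by simp_all
      then show "y \<in> map_prod ext ext ` L" by (rule rev_image_eqI)
    qed
  qed
  then have "card L = card ?A" by (rule bij_betw_same_card)
  with card_set_intervals[OF V D] show ?thesis by (simp add: L_def D_def)
qed

lemma finite_localization:
  assumes "finite V"
  shows "finite (localization B u)"
proof -
  have "finite (carrier B)" using bij_betw_finite[OF bij_ext] assms by simp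
  moreover have "localization B u \<subseteq> carrier B \<times> carrier B"
    by (auto simp: localization_def interval_algebra_def intro!: meet_closed join_closed neg_closed)
  ultimately show ?thesis by (meson finite_SigmaI finite_subset)
qed

end

section \<open>Sign vectors\<close>

definition sign_vectors :: "nat \<Rightarrow> nat set \<Rightarrow> (nat \<Rightarrow> int) set" where
  "sign_vectors k I = (\<Pi>\<^sub>E i\<in>{0..k}. if i \<in> I then {-1, 1} else {-1, 0, 1})"

definition leads_with :: "nat \<Rightarrow> int \<Rightarrow> (nat \<Rightarrow> int) \<Rightarrow> bool" where
  "leads_with k c f \<longleftrightarrow> (\<exists>i\<le>k. f i = c \<and> (\<forall>j<i. f j = 0))"

lemma card_sign_vectors:
  assumes "I \<subseteq> {0..k}"
  shows "card (sign_vectors k I) = 2 ^ card I * 3 ^ (k + 1 - card I)"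
proof -
  have "card (sign_vectors k I) = (\<Prod>i\<in>{0..k}. if i \<in> I then 2 else 3)"
    unfolding sign_vectors_def by (subst card_PiE) (auto intro!: prod.cong)
  also have "\<dots> = 2 ^ card ({0..k} \<inter> I) * 3 ^ card ({0..k} - I)"
    by (simp add: prod.If_cases Diff_eq)
  also have "{0..k} \<inter> I = I" using assms by auto
  also have "card ({0..k} - I) = k + 1 - card I"
    using assms by (subst card_Diff_subset) (auto intro: finite_subset)
  finally show ?thesis .
qed

lemma sign_vectors_at:
  "f \<in> sign_vectors k I \<Longrightarrow> i \<le> k \<Longrightarrow> f i \<in> (if i \<in> I then {-1, 1} else {-1, 0, 1})"
  unfolding sign_vectors_def by (rule PiE_mem) auto

lemma sign_vectors_D: "f \<in> sign_vectors k I \<Longrightarrow> i \<le> k \<Longrightarrow> f i \<in> {-1, 0, 1}"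
  using sign_vectors_at[of f k I i] by (auto split: if_splits)

lemma sign_vectors_nonzero: "f \<in> sign_vectors k I \<Longrightarrow> i \<le> k \<Longrightarrow> i \<in> I \<Longrightarrow> f i \<noteq> 0"
  using sign_vectors_at[of f k I i] by auto

text \<open>
  Negation exchanges the vectors with leading entry \<open>1\<close> and \<open>-1\<close>. As \<open>I\<close> is nonempty, every vector
  has a nonzero entry, so these two halves exhaust \<open>sign_vectors k I\<close>.
\<close>

lemma card_positive_sign_vectors:
  assumes I: "I \<subseteq> {0..k}" "I \<noteq> {}"
  shows "2 * card {f \<in> sign_vectors k I. leads_with k 1 f} = 2 ^ card I * 3 ^ (k + 1 - card I)"
proof -
  let ?P = "\<lambda>c. {f \<in> sign_vectors k I. leads_with k c f}"
  have "\<exists>c\<in>{-1, 1}. leads_with k c f" if f: "f \<in> sign_vectors k I" for f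
  proof -
    obtain i where i: "i \<in> I" using I by auto
    with I have ik: "i \<le> k" by auto
    have "f i \<noteq> 0" using sign_vectors_nonzero[OF f ik i] .
    define m where "m = (LEAST i. f i \<noteq> 0)"
    have m: "f m \<noteq> 0" "\<forall>j<m. f j = 0" "m \<le> i"
      unfolding m_def using LeastI[of "\<lambda>i. f i \<noteq> 0", OF \<open>f i \<noteq> 0\<close>] \<open>f i \<noteq> 0\<close>
      by (auto intro: Least_le dest: not_less_Least)
    moreover have "f m \<in> {-1, 0, 1}" using sign_vectors_D[OF f, of m] m(3) ik by simp
    ultimately have "f m \<in> {-1, 1}" by auto
    with m ik show ?thesis
      unfolding leads_with_def by (metis le_trans)
  qed
  then have union: "sign_vectors k I = ?P 1 \<union> ?P (-1)" by auto
  have disjoint: "?P 1 \<inter> ?P (-1) = {}"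
  proof -
    have False if "leads_with k 1 f" "leads_with k (-1) f" for f
    proof -
      from that obtain i j where "f i = 1" "\<forall>j<i. f j = 0" "f j = -1" "\<forall>i<j. f i = 0"
        by (auto simp: leads_with_def)
      then show False by (cases i j rule: linorder_cases) auto
    qed
    then show ?thesis by blast
  qed
  have bij: "bij_betw (\<lambda>f. \<lambda>i\<in>{0..k}. - f i) (?P 1) (?P (-1))"
  proof -
    let ?n = "\<lambda>f. \<lambda>i\<in>{0..k}. - (f i :: int)"
    have n: "?n f \<in> ?P (-c)" if "f \<in> ?P c" for f c
    proof -
      have "?n f \<in> sign_vectors k I"
        unfolding sign_vectors_def restrict_PiE_iff
        using that sign_vectors_at[of f k I] by (fastforce split: if_splits)
      moreover have "leads_with k (-c) (?n f)"
        using that unfolding leads_with_def by force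
      ultimately show ?thesis by simp
    qed
    have inv: "?n (?n f) = f" if "f \<in> ?P c" for f c
    proof
      fix i
      show "?n (?n f) i = f i"
        using that by (cases "i \<in> {0..k}") (auto simp: sign_vectors_def PiE_arb[of f])
    qed
    show ?thesis
      by (rule bij_betw_byWitness[where f' = ?n]) (use n[of _ 1] n[of _ "-1"] inv in auto)
  qed
  have "finite (sign_vectors k I)" unfolding sign_vectors_def by (intro finite_PiE) auto
  then have "card (?P 1 \<union> ?P (-1)) = card (?P 1) + card (?P (-1))"
    by (intro card_Un_disjoint disjoint) auto
  also have "card (?P (-1)) = card (?P 1)" by (rule bij_betw_same_card[OF bij, symmetric])
  finally show ?thesis using card_sign_vectors[OF I(1)] union by simp
qed

section \<open>The models of the relations of \<open>\<B>\<^sub>k\<close>\<close>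

lemma models_Bk_iff:
  "v \<in> models (Bk_gens k) (Bk_rels k) \<longleftrightarrow>
    v \<subseteq> Bk_gens k \<and> S 0 \<notin> v \<and> (\<forall>i\<le>k. S i \<in> v \<longrightarrow> T i \<in> v) \<and>
    (T 0 \<in> v \<longrightarrow> (\<forall>i<k. (\<exists>j\<in>{1..i}. S j \<in> v) \<or> T (Suc i) \<in> v) \<and> (\<exists>j\<in>{1..k}. S j \<in> v))"
proof -
  have ball_family: "(\<forall>x\<in>{f i | i. Q i}. P x) \<longleftrightarrow> (\<forall>i. Q i \<longrightarrow> P (f i))"
    for f :: "nat \<Rightarrow> gen bterm \<times> gen bterm" and Q P
    by blast
  have "(\<forall>(p, q)\<in>Bk_rels k. holds v p \<longleftrightarrow> holds v q) \<longleftrightarrow>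
    (holds v (Gen (S 0)) \<longleftrightarrow> holds v Bot) \<and>
    (\<forall>i\<le>k. case le_rel (Gen (S i)) (Gen (T i)) of (p, q) \<Rightarrow> holds v p \<longleftrightarrow> holds v q) \<and>
    (\<forall>i<k. case le_rel (Gen (T 0)) (Join (Joins (map (\<lambda>j. Gen (S j)) [1..<Suc i])) (Gen (T (Suc i))))
       of (p, q) \<Rightarrow> holds v p \<longleftrightarrow> holds v q) \<and>
    (case le_rel (Gen (T 0)) (Joins (map (\<lambda>j. Gen (S j)) [1..<Suc k]))
       of (p, q) \<Rightarrow> holds v p \<longleftrightarrow> holds v q)"
    unfolding Bk_rels_def ball_Un ball_family by simp
  also have "\<dots> \<longleftrightarrow> S 0 \<notin> v \<and> (\<forall>i\<le>k. S i \<in> v \<longrightarrow> T i \<in> v) \<and>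
    (T 0 \<in> v \<longrightarrow> (\<forall>i<k. (\<exists>j\<in>{1..i}. S j \<in> v) \<or> T (Suc i) \<in> v) \<and> (\<exists>j\<in>{1..k}. S j \<in> v))"
    by (simp add: le_rel_def atLeastLessThanSuc_atLeastAtMost del: upt_Suc) blast
  finally show ?thesis by (simp add: models_def)
qed

text \<open>
  The entry is \<open>0\<close> exactly where \<open>[s\<^sub>i,t\<^sub>i]\<close> is \<open>[0,1]\<close>. At index \<open>0\<close>, where \<open>s\<^sub>0 = 0\<close>, the remaining
  value \<open>[0,0]\<close> is recorded as \<open>1\<close> instead of \<open>-1\<close>; with this sign the case \<open>t\<^sub>0 = 0\<close> also has
  leading entry \<open>1\<close>.
\<close>

definition sign_vector :: "nat \<Rightarrow> gen set \<Rightarrow> nat \<Rightarrow> int" where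
  "sign_vector k v = (\<lambda>i\<in>{0..k}. if i = 0 then (if T 0 \<in> v then 0 else 1)
     else if S i \<in> v then 1 else if T i \<in> v then 0 else -1)"

definition model_of :: "nat \<Rightarrow> (nat \<Rightarrow> int) \<Rightarrow> gen set" where
  "model_of k f = {S i | i. i \<in> {1..k} \<and> f i = 1} \<union> {T i | i. i \<in> {1..k} \<and> f i \<ge> 0} 
    \<union> (if f 0 = 0 then {T 0} else {})"

lemma model_of_simps [simp]:
  "S i \<in> model_of k f \<longleftrightarrow> i \<in> {1..k} \<and> f i = 1"
  "T i \<in> model_of k f \<longleftrightarrow> (if i = 0 then f 0 = 0 else i \<le> k \<and> f i \<ge> 0)"
  by (auto simp: model_of_def)

text \<open>
  For \<open>t\<^sub>0 = 1\<close> let \<open>m\<close> be the least index with \<open>s\<^sub>m = 1\<close>, which exists by the last relation. The relation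
  \<open>t\<^sub>0 \<le> s\<^sub>1 \<or> \<dots> \<or> s\<^sub>i \<or> t\<^sub>i\<^sub>+\<^sub>1\<close> forces \<open>t\<^sub>i\<^sub>+\<^sub>1 = 1\<close> for \<open>i < m\<close> and holds trivially for \<open>i \<ge> m\<close>. So the
  relations say that the entries before \<open>m\<close> vanish and the entry at \<open>m\<close> is \<open>1\<close>.
\<close>

lemma bij_betw_sign_vector:
  assumes I: "I \<subseteq> {0..k}"
  shows "bij_betw (sign_vector k)
    {v \<in> models (Bk_gens k) (Bk_rels k). \<forall>i\<in>I. T i \<in> v \<longrightarrow> S i \<in> v}
    {f \<in> sign_vectors k I. leads_with k 1 f}"
proof (rule bij_betw_byWitness[where f' = "model_of k"])
  let ?M = "{v \<in> models (Bk_gens k) (Bk_rels k). \<forall>i\<in>I. T i \<in> v \<longrightarrow> S i \<in> v}"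
  let ?F = "{f \<in> sign_vectors k I. leads_with k 1 f}"
  have pos0: "f 0 \<noteq> -1" if "leads_with k 1 f" for f
    using that by (force simp: leads_with_def)
  show "\<forall>v\<in>?M. model_of k (sign_vector k v) = v"
  proof
    fix v assume v: "v \<in> ?M"
    have *: "S i \<in> v \<Longrightarrow> i \<le> k" "T i \<in> v \<Longrightarrow> i \<le> k" "S 0 \<notin> v" "S i \<in> v \<Longrightarrow> T i \<in> v" for i
    proof -
      have "v \<subseteq> Bk_gens k" "S 0 \<notin> v" "\<forall>i\<le>k. S i \<in> v \<longrightarrow> T i \<in> v"
        using v unfolding models_Bk_iff by auto
      then show "S i \<in> v \<Longrightarrow> i \<le> k" "T i \<in> v \<Longrightarrow> i \<le> k" "S 0 \<notin> v" "S i \<in> v \<Longrightarrow> T i \<in> v"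
        by (auto simp: Bk_gens_def)
    qed
    have "S i \<in> model_of k (sign_vector k v) \<longleftrightarrow> S i \<in> v" for i
      using *(1,2,4)[of i] *(3) by (cases "i = 0") (auto simp: sign_vector_def)
    moreover have "T i \<in> model_of k (sign_vector k v) \<longleftrightarrow> T i \<in> v" for i
      using *(1,2,4)[of i] *(3) by (auto simp: sign_vector_def)
    ultimately have "x \<in> model_of k (sign_vector k v) \<longleftrightarrow> x \<in> v" for x
      by (cases x) simp_all
    then show "model_of k (sign_vector k v) = v" by blast
  qed
  show "\<forall>f\<in>?F. sign_vector k (model_of k f) = f"
  proof
    fix f assume f: "f \<in> ?F"
    show "sign_vector k (model_of k f) = f"
    proof
      fix i
      show "sign_vector k (model_of k f) i = f i"
      proof (cases "i \<le> k")
        case True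
        then show ?thesis using f sign_vectors_D[of f k I i] pos0[of f]
          by (auto simp: sign_vector_def)
      next
        case False
        then show ?thesis using f by (auto simp: sign_vector_def sign_vectors_def PiE_arb[of f])
      qed
    qed
  qed
  show "sign_vector k ` ?M \<subseteq> ?F"
  proof
    fix f assume "f \<in> sign_vector k ` ?M"
    then obtain v where v: "v \<in> ?M" and f: "f = sign_vector k v" by blast
    have "leads_with k 1 (sign_vector k v)"
    proof (cases "T 0 \<in> v")
      case False
      then show ?thesis by (auto simp: leads_with_def sign_vector_def intro: exI[of _ 0])
    next
      case True
      then obtain j where j: "j \<in> {1..k}" "S j \<in> v" using v by (auto simp: models_Bk_iff)
      define m where "m = (LEAST j. j \<ge> 1 \<and> S j \<in> v)"
      have m: "m \<ge> 1 \<and> S m \<in> v" unfolding m_def by (rule LeastI[of _ j]) (use j in auto)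
      have "m \<le> j" unfolding m_def by (rule Least_le) (use j in auto)
      with j have mk: "m \<le> k" by simp
      have less: "S i \<notin> v" if "i \<ge> 1" "i < m" for i
        using that not_less_Least unfolding m_def by blast
      have "T i \<in> v" if "i \<ge> 1" "i < m" for i
      proof -
        have "i - 1 < k" using that mk by simp
        then have "(\<exists>j\<in>{1..i - 1}. S j \<in> v) \<or> T (Suc (i - 1)) \<in> v"
          using v True by (auto simp: models_Bk_iff)
        then show ?thesis using less that by force
      qed
      with True m mk less show ?thesis
        by (auto simp: leads_with_def sign_vector_def intro!: exI[of _ m])
    qed
    moreover have "sign_vector k v \<in> sign_vectors k I"
      using v by (auto simp: sign_vector_def sign_vectors_def models_Bk_iff)
    ultimately show "f \<in> ?F" using f by simp
  qed
  show "model_of k ` ?F \<subseteq> ?M"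
  proof
    fix v assume "v \<in> model_of k ` ?F"
    then obtain f where f: "f \<in> sign_vectors k I" "leads_with k 1 f" and v: "v = model_of k f" by blast
    then obtain m where m: "m \<le> k" "f m = 1" "\<And>j. j < m \<Longrightarrow> f j = 0"
      by (auto simp: leads_with_def)
    have gens: "v \<subseteq> Bk_gens k" by (auto simp: v model_of_def Bk_gens_def)
    have "v \<in> models (Bk_gens k) (Bk_rels k)"
    proof (cases m)
      case 0
      with m gens show ?thesis unfolding models_Bk_iff by (auto simp: v)
    next
      case (Suc m')
      have "\<exists>j\<in>{1..k}. S j \<in> v" using m Suc by (auto simp: v intro!: bexI[of _ m])
      moreover have "(\<exists>j\<in>{1..i}. S j \<in> v) \<or> T (Suc i) \<in> v" if "i < k" for i
      proof (cases "m \<le> i")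
        case True
        then show ?thesis using m Suc by (auto simp: v intro!: bexI[of _ m])
      next
        case False
        then have "f (Suc i) = 0 \<or> f (Suc i) = 1" using m(2) m(3)[of "Suc i"] by (cases "Suc i = m") auto
        then show ?thesis using that by (auto simp: v)
      qed
      ultimately show ?thesis
        using gens unfolding models_Bk_iff by (auto simp: v)
    qed
    moreover have "T i \<in> v \<longrightarrow> S i \<in> v" if "i \<in> I" for i
    proof -
      have "i \<le> k" using that I by auto
      then have "f i = -1 \<or> f i = 1" using sign_vectors_at[OF f(1)] that by fastforce
      then show ?thesis using \<open>i \<le> k\<close> pos0[OF f(2)] by (auto simp: v)
    qed
    ultimately show "v \<in> ?M" by blast
  qed
qed

section \<open>The cardinality of the union\<close>

lemma finite_Bk_gens: "finite (Bk_gens k)"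
  by (simp add: Bk_gens_def)

interpretation Bk: set_representation "Bk k" "models (Bk_gens k) (Bk_rels k)"
  "extension (Bk_gens k) (Bk_rels k)" for k
  unfolding Bk_def by (rule set_representation_presented_ba[OF finite_Bk_gens Bk_rels_subset])

lemma card_Inter_Bk_localizations:
  assumes I: "I \<subseteq> {0..k}" "I \<noteq> {}"
  shows "card (\<Inter>i\<in>I. localization (Bk k) (Bk_s k i, Bk_t k i))
    = 3 ^ (2 ^ (card I - 1) * 3 ^ (k + 1 - card I))"
proof -
  let ?V = "models (Bk_gens k) (Bk_rels k)" and ?e = "extension (Bk_gens k) (Bk_rels k)"
  have gens: "S i \<in> Bk_gens k" "T i \<in> Bk_gens k" if "i \<in> I" for i
    using that I by (auto simp: Bk_gens_def)
  have ext: "?e (Bk_s k i) = {v \<in> ?V. S i \<in> v}" "?e (Bk_t k i) = {v \<in> ?V. T i \<in> v}" if "i \<in> I" for i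
    using gens[OF that] by (simp_all add: Bk_s_def Bk_t_def extension_class)
  have "card (\<Inter>i\<in>I. localization (Bk k) (Bk_s k i, Bk_t k i))
      = 3 ^ card (?V - (\<Union>i\<in>I. ?e (Bk_t k i) - ?e (Bk_s k i)))"
  proof (rule Bk.card_Inter_localizations[OF finite_models[OF finite_Bk_gens] I(2)])
    fix i assume i: "i \<in> I"
    then show "Bk_s k i \<in> carrier (Bk k)" "Bk_t k i \<in> carrier (Bk k)"
      using gens by (auto simp: Bk_s_def Bk_t_def Bk_def carrier_presented_ba)
    show "?e (Bk_s k i) \<subseteq> ?e (Bk_t k i)"
      using i I by (auto simp: ext models_Bk_iff)
  qed
  also have "?V - (\<Union>i\<in>I. ?e (Bk_t k i) - ?e (Bk_s k i)) = {v \<in> ?V. \<forall>i\<in>I. T i \<in> v \<longrightarrow> S i \<in> v}"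
    using ext by auto
  also have "card \<dots> = 2 ^ (card I - 1) * 3 ^ (k + 1 - card I)"
  proof -
    have "card I > 0" using I by (meson card_gt_0_iff finite_atLeastAtMost finite_subset)
    then have "2 ^ card I = 2 * (2::nat) ^ (card I - 1)" by (cases "card I") auto
    then show ?thesis
      using card_positive_sign_vectors[OF I] bij_betw_same_card[OF bij_betw_sign_vector[OF I(1)]] by simp
  qed
  finally show ?thesis .
qed

lemma three_powr_\<Phi>:
  assumes "l \<le> k"
  shows "3 powr \<Phi> k l = real (3 ^ (2 ^ l * 3 ^ (k - l)))"
proof -
  have "3 ^ k = (3::real) ^ l * 3 ^ (k - l)"
    using assms by (simp flip: power_add)
  then have "\<Phi> k l = real (2 ^ l * 3 ^ (k - l))"
    by (simp add: \<Phi>_def power_divide)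
  then show ?thesis by (simp only: powr_realpow zero_less_numeral of_nat_power of_nat_numeral)
qed

theorem mainTheorem2:
  fixes k :: nat and X :: "'x set"
  assumes "finite X" and "card X = k + 1"
  shows "finite (\<L>_union k) \<and>
    real (card (\<L>_union k)) =
      (\<Sum>i=1..k+1. real ((k + 1) choose i) * (-1) ^ (i + 1) * 3 powr \<Phi> k (i - 1))"
proof
  let ?L = "\<lambda>i. localization (Bk k) (Bk_s k i, Bk_t k i)"
  let ?N = "{I. I \<subseteq> {0..k} \<and> I \<noteq> {}}"
  have fin: "finite (?L i)" for i
    by (rule Bk.finite_localization[OF finite_models[OF finite_Bk_gens]])
  then show "finite (\<L>_union k)" by (simp add: \<L>_union_def)
  interpret Incl_Excl finite "real \<circ> card"
    by unfold_locales (auto simp: card_Un_disjnt)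
  have card_N: "card I \<in> {1..k+1}" if "I \<in> ?N" for I
  proof -
    have "finite I" using that by (auto intro: finite_subset)
    then show ?thesis using that card_mono[of "{0..k}" I] by (auto simp: Suc_le_eq card_gt_0_iff)
  qed
  have "real (card (\<L>_union k)) = (\<Sum>I\<in>?N. (-1) ^ (card I + 1) * real (card (\<Inter> (?L ` I))))"
    using restricted_indexed[of "{0..k}" ?L] fin by (simp add: \<L>_union_def)
  also have "\<dots> = (\<Sum>I\<in>?N. (-1) ^ (card I + 1) * 3 powr \<Phi> k (card I - 1))"
  proof (rule sum.cong[OF HOL.refl])
    fix I assume I: "I \<in> ?N"
    then have e: "k + 1 - card I = k - (card I - 1)" and le: "card I - 1 \<le> k"
      using card_N[of I] by auto
    have "card (\<Inter> (?L ` I)) = 3 ^ (2 ^ (card I - 1) * 3 ^ (k - (card I - 1)))"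
      using card_Inter_Bk_localizations[of I k] I unfolding e by blast
    then show "(-1) ^ (card I + 1) * real (card (\<Inter> (?L ` I))) = (-1) ^ (card I + 1) * 3 powr \<Phi> k (card I - 1)"
      by (simp only: three_powr_\<Phi>[OF le])
  qed
  also have "\<dots> = (\<Sum>i=1..k+1. \<Sum>I | I \<in> ?N \<and> card I = i. (-1) ^ (card I + 1) * 3 powr \<Phi> k (card I - 1))"
  proof (rule sum.group[symmetric])
    show "card ` ?N \<subseteq> {1..k+1}" by (rule image_subsetI) (rule card_N)
  qed simp_all
  also have "\<dots> = (\<Sum>i=1..k+1. real ((k + 1) choose i) * (-1) ^ (i + 1) * 3 powr \<Phi> k (i - 1))"
  proof (rule sum.cong[OF HOL.refl])
    fix i assume i: "i \<in> {1..k+1}"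
    have "{I. I \<in> ?N \<and> card I = i} = {I. I \<subseteq> {0..k} \<and> card I = i}" using i by auto
    then have "card {I. I \<in> ?N \<and> card I = i} = (k + 1) choose i"
      using n_subsets[of "{0..k}" i] by simp
    then show "(\<Sum>I | I \<in> ?N \<and> card I = i. (-1) ^ (card I + 1) * 3 powr \<Phi> k (card I - 1))
        = real ((k + 1) choose i) * (-1) ^ (i + 1) * 3 powr \<Phi> k (i - 1)"
      by simp
  qed
  finally show "real (card (\<L>_union k)) =
      (\<Sum>i=1..k+1. real ((k + 1) choose i) * (-1) ^ (i + 1) * 3 powr \<Phi> k (i - 1))" .
qed

end
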